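(* Suppose there exists $\bar x\in\mathbb R^n$ with $q_1(\bar x)<0$ and there exists $\bar\gamma\ge0$ with $A(\bar\gamma)\succ0$. Suppose $\mu^*>0$ and that the interval $[\gamma^{(1)},\gamma^{(2)}]\subseteq\mathbb R_+$ contains $\gamma^*$. Then $\nu(\gamma^* )=0$, and $x(\gamma^* )$ is the unique optimizer of both $$\inf_{x\in\mathbb R^n}\{q_0(x): q_1(x)\le0\}\qquad\text{and}\qquad \inf_{x\in\mathbb R^n}\max\left(q(\gamma^{(1)},x),\,q(\gamma^{(2)},x)\right).$$ In particular, taking $[\gamma^{(1)},\gamma^{(2)}]\subseteq\mathrm{int}(\Gamma)$, $x(\gamma^* )$ is the unique optimizer of the second problem, which is then a strongly convex problem.
   Context: For $i\in\{0,1\}$, $q_i(x)=x^\top A_ix+2b_i^\top x+c_i$ with $A_i$ a real symmetric $n\times n$ matrix, $b_i\in\mathbb R^n$, $c_i\in\mathbb R$. For $\gamma\ge0$: $A(\gamma)=A_0+\gamma A_1$, $b(\gamma)=b_0+\gamma b_1$, $q(\gamma,x)=q_0(x)+\gamma q_1(x)$, and $\mathbf d(\gamma)=\inf_{x\in\mathbb R^n}q(\gamma,x)\in\mathbb R\cup\{-\infty\}$. $\Gamma=\{\gamma\ge0:A(\gamma)\succeq0\}$, a closed interval; $\mathrm{int}(\Gamma)$ is its interior. $\mu(\gamma)=\lambda_{\min}(A(\gamma))$. For $\gamma\in\mathrm{int}(\Gamma)$, $x(\gamma)=-A(\gamma)^{-1}b(\gamma)$ and $\nu(\gamma)=q_1(x(\gamma))$.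 Under the stated hypotheses on $\bar x,\bar\gamma$, $\arg\max_{\gamma\ge0}\mathbf d(\gamma)$ is either a single point or all of $\Gamma$ (and in the latter case $\Gamma$ is compact). If $\mathbf d$ has a unique maximizer over $\mathbb R_+$, then $\gamma^*$ denotes that maximizer; otherwise $\arg\max_{\gamma\ge0}\mathbf d(\gamma)=\Gamma$ and $\gamma^*$ is an element of $\arg\max_{\gamma\in\Gamma}\mu(\gamma)$ (for concreteness, the smallest one). The regularity is $\mu^*=\mu(\gamma^* )$.
   Formalization: The claim ν(γ* )=0 is asserted only when γ* lies in int(Γ), where ν is defined; it fails for γ*=0 (n=1, q_0=x², q_1=x²−1 gives γ*=0, μ*=1, q_1(x(0))=−1). The unique-optimizer claims are kept for every γ*. *)

theory Defs
  imports "HOL-Analysis.Analysis"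
begin

definition pos_semidef :: "real^'n^'n \<Rightarrow> bool"
  where "pos_semidef A \<longleftrightarrow> transpose A = A \<and> (\<forall>x. 0 \<le> x \<bullet> (A *v x))"

definition pos_def :: "real^'n^'n \<Rightarrow> bool"
  where "pos_def A \<longleftrightarrow> transpose A = A \<and> (\<forall>x. x \<noteq> 0 \<longrightarrow> 0 < x \<bullet> (A *v x))"

definition eigenvalue_of :: "real^'n^'n \<Rightarrow> real \<Rightarrow> bool"
  where "eigenvalue_of A l \<longleftrightarrow> (\<exists>v. v \<noteq> 0 \<and> A *v v = l *\<^sub>R v)"

(* Meaningful for symmetric matrices, which have a smallest real eigenvalue. *)
definition lambda_min :: "real^'n^'n \<Rightarrow> real"
  where "lambda_min A = (LEAST l. eigenvalue_of A l)"

definition strongly_convex_on :: "'a::real_inner set \<Rightarrow> ('a \<Rightarrow> real) \<Rightarrow> bool"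
  where "strongly_convex_on S f \<longleftrightarrow> convex S \<and>
    (\<exists>\<alpha>>0. \<forall>x\<in>S. \<forall>y\<in>S. \<forall>t\<in>{0..1}.
      f ((1 - t) *\<^sub>R x + t *\<^sub>R y)
        \<le> (1 - t) * f x + t * f y - \<alpha> / 2 * t * (1 - t) * (norm (x - y))\<^sup>2)"

definition unique_minimizer :: "('a \<Rightarrow> real) \<Rightarrow> ('a \<Rightarrow> bool) \<Rightarrow> 'a \<Rightarrow> bool"
  where "unique_minimizer f P x \<longleftrightarrow> is_arg_min f P x \<and> (\<forall>y. is_arg_min f P y \<longrightarrow> y = x)"

record 'n quadratic =
  Mat :: "real^'n^'n"
  Vec :: "real^'n"
  Const :: real

definition qval :: "'n::finite quadratic \<Rightarrow> real^'n \<Rightarrow> real"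
  where "qval Q x = x \<bullet> (Mat Q *v x) + 2 * (Vec Q \<bullet> x) + Const Q"

definition A_of :: "'n::finite quadratic \<Rightarrow> 'n quadratic \<Rightarrow> real \<Rightarrow> real^'n^'n"
  where "A_of Q0 Q1 \<gamma> = Mat Q0 + \<gamma> *\<^sub>R Mat Q1"

definition b_of :: "'n::finite quadratic \<Rightarrow> 'n quadratic \<Rightarrow> real \<Rightarrow> real^'n"
  where "b_of Q0 Q1 \<gamma> = Vec Q0 + \<gamma> *\<^sub>R Vec Q1"

definition q_of :: "'n::finite quadratic \<Rightarrow> 'n quadratic \<Rightarrow> real \<Rightarrow> real^'n \<Rightarrow> real"
  where "q_of Q0 Q1 \<gamma> x = qval Q0 x + \<gamma> * qval Q1 x"

definition dual :: "'n::finite quadratic \<Rightarrow> 'n quadratic \<Rightarrow> real \<Rightarrow> ereal"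
  where "dual Q0 Q1 \<gamma> = (INF x. ereal (q_of Q0 Q1 \<gamma> x))"

definition Gamma_set :: "'n::finite quadratic \<Rightarrow> 'n quadratic \<Rightarrow> real set"
  where "Gamma_set Q0 Q1 = {\<gamma>. 0 \<le> \<gamma> \<and> pos_semidef (A_of Q0 Q1 \<gamma>)}"

definition mu :: "'n::finite quadratic \<Rightarrow> 'n quadratic \<Rightarrow> real \<Rightarrow> real"
  where "mu Q0 Q1 \<gamma> = lambda_min (A_of Q0 Q1 \<gamma>)"

(* Meaningful only where A_of Q0 Q1 \<gamma> is invertible; this covers the interior of Gamma_set
   when the pencil has a positive definite member at some nonnegative \<gamma>, and also \<gamma> = 0 if
   Mat Q0 is positive definite. *)
definition x_of :: "'n::finite quadratic \<Rightarrow> 'n quadratic \<Rightarrow> real \<Rightarrow> real^'n"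
  where "x_of Q0 Q1 \<gamma> = - (matrix_inv (A_of Q0 Q1 \<gamma>) *v b_of Q0 Q1 \<gamma>)"

(* For \<gamma> in the interior of Gamma_set (taken in the reals, so \<gamma> > 0), nu is the derivative of
   dual at \<gamma>. It need not vanish at a dual maximizer \<gamma> = 0, where only nu \<le> 0 holds:
   take q0(x) = x^2 and q1(x) = x^2 - 1, with maximizer 0 and nu = -1. *)
definition nu :: "'n::finite quadratic \<Rightarrow> 'n quadratic \<Rightarrow> real \<Rightarrow> real"
  where "nu Q0 Q1 \<gamma> = qval Q1 (x_of Q0 Q1 \<gamma>)"

definition dual_maximizer :: "'n::finite quadratic \<Rightarrow> 'n quadratic \<Rightarrow> real \<Rightarrow> bool"
  where "dual_maximizer Q0 Q1 = is_arg_max (dual Q0 Q1) (\<lambda>\<gamma>. 0 \<le> \<gamma>)"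

definition gamma_star :: "'n::finite quadratic \<Rightarrow> 'n quadratic \<Rightarrow> real"
  where "gamma_star Q0 Q1 =
    (if \<exists>!\<gamma>. dual_maximizer Q0 Q1 \<gamma> then THE \<gamma>. dual_maximizer Q0 Q1 \<gamma>
     else LEAST \<gamma>. is_arg_max (mu Q0 Q1) (\<lambda>\<gamma>. \<gamma> \<in> Gamma_set Q0 Q1) \<gamma>)"

definition mu_star :: "'n::finite quadratic \<Rightarrow> 'n quadratic \<Rightarrow> real"
  where "mu_star Q0 Q1 = mu Q0 Q1 (gamma_star Q0 Q1)"

end

theory Submission
  imports Defs
begin

text \<open>
  With \<open>\<gamma>\<close> the selected multiplier and \<open>x = x(\<gamma>)\<close>, the only analytic input is the bound
  \<open>d(\<gamma> + h) \<ge> d(\<gamma>) + h q\<^sub>1(x) - C h\<^sup>2\<close>, obtained by completing the square. Since \<open>\<gamma>\<close>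
  maximizes the dual it forces \<open>q\<^sub>1(x) \<le> 0\<close>, with equality if \<open>\<gamma> > 0\<close>; both optimality
  claims are then weak duality made strict by \<open>A(\<gamma>) \<succ> 0\<close>.

  If the dual has two maximizers, the minimizers \<open>x(\<delta>)\<close> for \<open>\<delta>\<close> strictly between them
  coincide in a point \<open>y\<close> with \<open>q\<^sub>1(y) = 0\<close>. Being affine in \<open>\<delta>\<close>, the gradient
  \<open>A(\<delta>) y + b(\<delta>)\<close> vanishes identically, so \<open>y\<close> minimizes \<open>q(\<delta>, \<cdot>)\<close> for every \<open>\<delta> \<in> \<Gamma>\<close>
  and the dual is constant on \<open>\<Gamma>\<close>.
\<close>

section \<open>Quadratic forms on the unit sphere and the smallest eigenvalue\<close>

lemma quadratic_form_ge_on_sphere: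
  fixes A :: "real^'n^'n"
  assumes "\<And>x. norm x = 1 \<Longrightarrow> m \<le> x \<bullet> (A *v x)"
  shows "m * (norm x)\<^sup>2 \<le> x \<bullet> (A *v x)"
proof (cases "x = 0")
  case False
  define u where "u = x /\<^sub>R norm x"
  have x: "x = norm x *\<^sub>R u" and u: "norm u = 1"
    using False by (auto simp: u_def)
  have "x \<bullet> (A *v x) = (norm x)\<^sup>2 * (u \<bullet> (A *v u))"
    by (subst (1 2) x) (simp add: matrix_vector_mult_scaleR power2_eq_square)
  with assms[OF u] show ?thesis
    by (simp add: mult.commute[of m] mult_left_mono)
qed simp

lemma quadratic_form_attains_min_on_sphere:
  fixes A :: "real^'n^'n"
  obtains v where "norm v = 1" "\<And>x. norm x = 1 \<Longrightarrow> v \<bullet> (A *v v) \<le> x \<bullet> (A *v x)"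
proof -
  have "continuous_on (sphere 0 1) (\<lambda>x. x \<bullet> (A *v x))"
    by (intro continuous_intros matrix_vector_mult_linear_continuous_on)
  moreover have "sphere (0::real^'n) 1 \<noteq> {}"
    by simp
  ultimately obtain v where "v \<in> sphere 0 1" "\<forall>x\<in>sphere 0 1. v \<bullet> (A *v v) \<le> x \<bullet> (A *v x)"
    using continuous_attains_inf[OF compact_sphere] by blast
  then show ?thesis
    using that by auto
qed

text \<open>The minimum over the compact unit sphere is positive, and homogeneity carries it to all
  vectors. Strong convexity and the dual bound below both need such a uniform
  \<open>m\<close>.\<close>

lemma pos_def_coercive:
  assumes "pos_def A"
  obtains m where "m > 0" "\<And>x. m * (norm x)\<^sup>2 \<le> x \<bullet> (A *v x)"
proof -
  obtain v where v: "norm v = 1" "\<And>x. norm x = 1 \<Longrightarrow> v \<bullet> (A *v v) \<le> x \<bullet> (A *v x)"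
    using quadratic_form_attains_min_on_sphere by blast
  have "v \<noteq> 0"
    using v(1) by auto
  with assms have "v \<bullet> (A *v v) > 0"
    by (simp add: pos_def_def)
  then show ?thesis
    using that quadratic_form_ge_on_sphere[OF v(2)] by blast
qed

lemma quadratic_form_bounded:
  fixes A :: "real^'n^'n"
  obtains K where "K > 0" "\<And>x. \<bar>x \<bullet> (A *v x)\<bar> \<le> K * (norm x)\<^sup>2"
proof -
  obtain K where K: "K > 0" "\<And>x. norm (A *v x) \<le> norm x * K"
    using bounded_linear.pos_bounded[OF matrix_vector_mul_bounded_linear[of A]] by blast
  have "\<bar>x \<bullet> (A *v x)\<bar> \<le> K * (norm x)\<^sup>2" for x
  proof -
    have "\<bar>x \<bullet> (A *v x)\<bar> \<le> norm x * norm (A *v x)"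
      by (rule Cauchy_Schwarz_ineq2)
    also have "\<dots> \<le> norm x * (norm x * K)"
      by (intro mult_left_mono K) simp
    finally show ?thesis
      by (simp add: power2_eq_square mult_ac)
  qed
  with K(1) that show ?thesis by blast
qed

lemma pos_def_imp_invertible:
  assumes "pos_def A"
  shows "invertible A"
proof -
  have "x = 0" if "A *v x = 0" for x
    using assms that by (force simp: pos_def_def)
  then show ?thesis
    by (simp add: invertible_left_inverse matrix_left_invertible_ker)
qed

lemma symmetric_inner_commute:
  fixes A :: "real^'n^'n"
  assumes "transpose A = A"
  shows "x \<bullet> (A *v y) = y \<bullet> (A *v x)"
proof -
  have "x \<bullet> (A *v y) = (transpose A *v x) \<bullet> y"
    by (simp only: transpose_matrix_vector dot_lmul_matrix)
  then show ?thesis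
    by (simp add: assms inner_commute)
qed

text \<open>A nonnegative polynomial that vanishes at \<open>t = 0\<close> has a minimum there, so
  its derivative \<open>2 * a\<close> at that point is zero.\<close>

lemma nonneg_linear_perturbation:
  fixes a b :: real
  assumes "\<And>t. 0 \<le> 2 * t * a + t\<^sup>2 * b"
  shows "a = 0"
proof (rule ccontr)
  assume a: "a \<noteq> 0"
  define s where "s = \<bar>b\<bar> + 1"
  have s: "s > 0" "b < s" by (auto simp: s_def)
  have "0 \<le> 2 * (- a / s) * a + (- a / s)\<^sup>2 * b"
    by (rule assms)
  also have "\<dots> = (a\<^sup>2 / s) * (b / s - 2)"
    using s by (simp add: field_simps power2_eq_square)
  also have "\<dots> < 0"
    using s a by (intro mult_pos_neg) (auto simp: field_simps)
  finally show False by simp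
qed

text \<open>Rayleigh's principle: the minimum of the form on the unit sphere is itself an
  eigenvalue, and testing with eigenvectors shows that none is smaller. In particular the
  \<open>LEAST\<close> in \<open>lambda_min\<close> is attained.\<close>

lemma lambda_min_le_quadratic_form:
  fixes A :: "real^'n^'n"
  assumes sym: "transpose A = A"
  shows "lambda_min A * (norm x)\<^sup>2 \<le> x \<bullet> (A *v x)"
proof -
  obtain v where v: "norm v = 1" "\<And>x. norm x = 1 \<Longrightarrow> v \<bullet> (A *v v) \<le> x \<bullet> (A *v x)"
    using quadratic_form_attains_min_on_sphere by blast
  define m where "m = v \<bullet> (A *v v)"
  have ge: "m * (norm x)\<^sup>2 \<le> x \<bullet> (A *v x)" for x
    using quadratic_form_ge_on_sphere v(2) unfolding m_def by blast
  \<comment> \<open>The form of \<open>A\<close> minus \<open>m\<close> times the identity is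
    nonnegative and vanishes at \<open>v\<close>, so its first variation there is zero in every
    direction \<open>y\<close>.\<close>
  have "y \<bullet> (A *v v) - m * (y \<bullet> v) = 0" for y
  proof (rule nonneg_linear_perturbation)
    fix t
    have "m * ((v + t *\<^sub>R y) \<bullet> (v + t *\<^sub>R y)) \<le> (v + t *\<^sub>R y) \<bullet> (A *v (v + t *\<^sub>R y))"
      using ge by (simp add: dot_square_norm)
    moreover have "(v + t *\<^sub>R y) \<bullet> (v + t *\<^sub>R y) = 1 + 2 * t * (y \<bullet> v) + t\<^sup>2 * (y \<bullet> y)"
    proof -
      have "v \<bullet> v = 1"
        using v(1) by (simp add: dot_square_norm)
      then show ?thesis
        by (simp only: inner_add_left inner_add_right inner_scaleR_left inner_scaleR_right
            inner_commute[of v y]) (simp add: power2_eq_square algebra_simps)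
    qed
    moreover have "(v + t *\<^sub>R y) \<bullet> (A *v (v + t *\<^sub>R y)) =
        m + 2 * t * (y \<bullet> (A *v v)) + t\<^sup>2 * (y \<bullet> (A *v y))"
      using symmetric_inner_commute[OF sym, of v y]
      by (simp add: m_def inner_add_left inner_add_right matrix_vector_right_distrib
          matrix_vector_mult_scaleR power2_eq_square algebra_simps)
    ultimately have "m * (1 + 2 * t * (y \<bullet> v) + t\<^sup>2 * (y \<bullet> y))
        \<le> m + 2 * t * (y \<bullet> (A *v v)) + t\<^sup>2 * (y \<bullet> (A *v y))"
      by metis
    then show "0 \<le> 2 * t * (y \<bullet> (A *v v) - m * (y \<bullet> v))
        + t\<^sup>2 * (y \<bullet> (A *v y) - m * (y \<bullet> y))"
      by (simp add: algebra_simps)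
  qed
  \<comment> \<open>The direction \<open>y\<close> is taken to be the residual itself.\<close>
  then have "(A *v v - m *\<^sub>R v) \<bullet> (A *v v - m *\<^sub>R v) = 0"
    by (metis inner_diff_right inner_scaleR_right)
  then have "eigenvalue_of A m"
    using v(1) unfolding eigenvalue_of_def by (intro exI[of _ v]) auto
  moreover have "m \<le> l" if ev: "eigenvalue_of A l" for l
  proof -
    obtain w where w: "w \<noteq> 0" "A *v w = l *\<^sub>R w"
      using ev by (auto simp: eigenvalue_of_def)
    have "m * (norm w)\<^sup>2 \<le> l * (norm w)\<^sup>2"
      using ge[of w] w(2) by (simp add: dot_square_norm)
    with w(1) show ?thesis by simp
  qed
  ultimately have "lambda_min A = m"
    unfolding lambda_min_def by (rule Least_equality)
  with ge show ?thesis by simp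
qed

lemma pos_def_if_lambda_min_pos:
  fixes A :: "real^'n^'n"
  assumes "transpose A = A" "lambda_min A > 0"
  shows "pos_def A"
  unfolding pos_def_def
proof (intro conjI allI impI)
  fix x :: "real^'n"
  assume "x \<noteq> 0"
  with assms(2) have "0 < lambda_min A * (norm x)\<^sup>2"
    by simp
  also have "\<dots> \<le> x \<bullet> (A *v x)"
    by (rule lambda_min_le_quadratic_form[OF assms(1)])
  finally show "0 < x \<bullet> (A *v x)" .
qed (fact assms(1))

section \<open>Exact expansions of a single quadratic function\<close>

lemma qval_add:
  assumes "transpose (Mat Q) = Mat Q"
  shows "qval Q (x + y) = qval Q x + 2 * ((Mat Q *v x + Vec Q) \<bullet> y) + y \<bullet> (Mat Q *v y)"
  using symmetric_inner_commute[OF assms, of x y]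
  by (simp add: qval_def inner_add_left inner_add_right matrix_vector_right_distrib inner_commute
      algebra_simps)

lemma qval_affine_combination:
  assumes "transpose (Mat Q) = Mat Q"
  shows "qval Q ((1 - t) *\<^sub>R x + t *\<^sub>R y) =
    (1 - t) * qval Q x + t * qval Q y - t * (1 - t) * ((x - y) \<bullet> (Mat Q *v (x - y)))"
proof -
  have eq: "(1 - t) *\<^sub>R x + t *\<^sub>R y = x + t *\<^sub>R (y - x)" "y = x + (y - x)"
    by (auto simp: algebra_simps)
  have "(x - y) \<bullet> (Mat Q *v (x - y)) = (y - x) \<bullet> (Mat Q *v (y - x))"
    by (simp add: matrix_vector_mult_diff_distrib inner_diff_left inner_diff_right)
  then show ?thesis
    using qval_add[OF assms, of x "t *\<^sub>R (y - x)"]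
      qval_add[OF assms, of x "y - x", folded eq(2)]
    unfolding eq(1) by (simp add: matrix_vector_mult_scaleR algebra_simps power2_eq_square
        del: scaleR_diff_right inner_diff_right inner_diff_left add_diff_cancel)
qed

text \<open>Adding the values at two opposite points cancels the linear term, so along a direction
  of negative curvature the sum would be unbounded below.\<close>

lemma bounded_below_quadratic_form_nonneg:
  assumes "\<And>x. D \<le> qval Q x"
  shows "0 \<le> x \<bullet> (Mat Q *v x)"
proof (rule ccontr)
  assume "\<not> 0 \<le> x \<bullet> (Mat Q *v x)"
  then have neg: "x \<bullet> (Mat Q *v x) < 0" by simp
  \<comment> \<open>Chosen so that scaling the form by \<open>t * t = s\<close> gives
    \<open>- (\<bar>Const Q - D\<bar> + 1)\<close>, which pushes the mean of the two values below
    \<open>D\<close>.\<close>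
  define s where "s = (\<bar>Const Q - D\<bar> + 1) / - (x \<bullet> (Mat Q *v x))"
  define t where "t = sqrt s"
  have "s \<ge> 0"
    using neg by (simp add: s_def divide_nonneg_neg)
  then have t: "t * t = s"
    by (simp add: t_def)
  have "2 * D \<le> qval Q (t *\<^sub>R x) + qval Q (- t *\<^sub>R x)"
    using assms[of "t *\<^sub>R x"] assms[of "- t *\<^sub>R x"] by simp
  also have "\<dots> = 2 * ((t * t) * (x \<bullet> (Mat Q *v x)) + Const Q)"
    by (simp add: qval_def matrix_vector_mult_scaleR algebra_simps
        del: scaleR_minus_left)
  also have "\<dots> = 2 * (Const Q - \<bar>Const Q - D\<bar> - 1)"
    using neg unfolding t by (simp add: s_def field_simps)
  finally show False
    by (auto simp: abs_if split: if_splits)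
qed

section \<open>The pencil of the two quadratics and the existence of dual maximizers\<close>

context
  fixes Q0 Q1 :: "'n::finite quadratic"
begin

text \<open>Repackages the aggregated function as one record, so that the lemmas on
  \<open>qval\<close> apply to it.\<close>

definition pencil :: "real \<Rightarrow> 'n quadratic"
  where "pencil \<gamma> = \<lparr>Mat = A_of Q0 Q1 \<gamma>, Vec = b_of Q0 Q1 \<gamma>, Const = Const Q0 + \<gamma> * Const Q1\<rparr>"

lemma qval_pencil: "qval (pencil \<gamma>) x = q_of Q0 Q1 \<gamma> x"
  by (simp add: qval_def q_of_def pencil_def A_of_def b_of_def matrix_vector_mult_add_rdistrib
      inner_add_left inner_add_right scaleR_matrix_vector_assoc[symmetric] algebra_simps)

lemma pencil_form:
  "x \<bullet> (A_of Q0 Q1 \<gamma> *v x) = x \<bullet> (Mat Q0 *v x) + \<gamma> * (x \<bullet> (Mat Q1 *v x))"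
  by (simp add: A_of_def matrix_vector_mult_add_rdistrib inner_add_right
      scaleR_matrix_vector_assoc[symmetric])

lemma q_of_shift: "q_of Q0 Q1 (\<gamma> + h) x = q_of Q0 Q1 \<gamma> x + h * qval Q1 x"
  by (simp add: q_of_def algebra_simps)

lemma le_dual_iff: "ereal D \<le> dual Q0 Q1 \<gamma> \<longleftrightarrow> (\<forall>x. D \<le> q_of Q0 Q1 \<gamma> x)"
  by (simp add: dual_def le_INF_iff)

text \<open>For fixed \<open>x\<close> the form is affine in the multiplier. Being nonnegative at
  both ends, it can vanish strictly between them only by vanishing identically, which positivity at
  \<open>\<delta>\<close> excludes wherever \<open>\<delta>\<close> lies.\<close>

lemma pos_def_between:
  assumes "pos_semidef (A_of Q0 Q1 \<alpha>)" "pos_semidef (A_of Q0 Q1 \<beta>)" "pos_def (A_of Q0 Q1 \<delta>)"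
    and "\<alpha> < \<gamma>" "\<gamma> < \<beta>" and "transpose (A_of Q0 Q1 \<gamma>) = A_of Q0 Q1 \<gamma>"
  shows "pos_def (A_of Q0 Q1 \<gamma>)"
  unfolding pos_def_def
proof (intro conjI allI impI)
  fix x :: "real^'n"
  assume "x \<noteq> 0"
  define u v where "u = x \<bullet> (Mat Q0 *v x)" and "v = x \<bullet> (Mat Q1 *v x)"
  have d: "0 < u + \<delta> * v"
    using assms(3) \<open>x \<noteq> 0\<close> by (simp add: pos_def_def pencil_form u_def v_def)
  have a: "0 \<le> u + \<alpha> * v" and b: "0 \<le> u + \<beta> * v"
    using assms(1,2) by (auto simp: pos_semidef_def pencil_form u_def v_def)
  have "0 < u + \<gamma> * v"
  proof (cases v "0::real" rule: linorder_cases)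
    case less
    then have "\<beta> * v < \<gamma> * v" using assms(5) by simp
    with b show ?thesis by linarith
  next
    case greater
    then have "\<alpha> * v < \<gamma> * v" using assms(4) by simp
    with a show ?thesis by linarith
  next
    case equal
    with d show ?thesis by simp
  qed
  then show "0 < x \<bullet> (A_of Q0 Q1 \<gamma> *v x)"
    by (simp add: pencil_form u_def v_def)
qed (fact assms(6))

text \<open>The left-hand side is half the gradient of \<open>q_of Q0 Q1 \<gamma>\<close>. Later
  arguments know \<open>x_of\<close> only through this equation.\<close>

lemma x_of_stationary:
  assumes "pos_def (A_of Q0 Q1 \<gamma>)"
  shows "A_of Q0 Q1 \<gamma> *v x_of Q0 Q1 \<gamma> + b_of Q0 Q1 \<gamma> = 0"
proof -
  have "A_of Q0 Q1 \<gamma> ** matrix_inv (A_of Q0 Q1 \<gamma>) = mat 1"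
    using pos_def_imp_invertible[OF assms] someI_ex
    unfolding invertible_def matrix_inv_def by (metis (mono_tags, lifting))
  moreover have "A_of Q0 Q1 \<gamma> *v (- y) = - (A_of Q0 Q1 \<gamma> *v y)" for y
    using matrix_vector_mult_scaleR[of "A_of Q0 Q1 \<gamma>" "-1" y] by simp
  ultimately show ?thesis
    by (simp add: x_of_def matrix_vector_mul_assoc)
qed

text \<open>The dual is an infimum of affine functions of the multiplier, so its superlevel sets
  \<open>L c\<close> are closed; the Slater point \<open>z\<close> bounds them, since
  \<open>q_of\<close> at \<open>z\<close> decreases in the multiplier. A maximizer is found in a
  nested intersection of these compact sets.\<close>

lemma dual_maximizer_exists:
  assumes "\<gamma>0 \<ge> 0" "\<forall>x. c \<le> q_of Q0 Q1 \<gamma>0 x" "qval Q1 z < 0"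
  obtains \<gamma> where "dual_maximizer Q0 Q1 \<gamma>"
proof -
  define L where "L c = {\<gamma>. 0 \<le> \<gamma> \<and> (\<forall>x. c \<le> q_of Q0 Q1 \<gamma> x)}" for c
  have "compact (L c)" for c
  proof -
    have "L c = {0..} \<inter> (\<Inter>x. {\<gamma>. c \<le> q_of Q0 Q1 \<gamma> x})"
      by (auto simp: L_def)
    moreover have "closed {\<gamma>. c \<le> q_of Q0 Q1 \<gamma> x}" for x
      unfolding q_of_def by (intro closed_Collect_le continuous_intros)
    ultimately have "closed (L c)"
      by (metis closed_INT closed_Int closed_atLeast)
    moreover have "L c \<subseteq> {0..(qval Q0 z - c) / - qval Q1 z}"
    proof
      fix \<gamma> assume "\<gamma> \<in> L c"
      then have "0 \<le> \<gamma>" "c \<le> qval Q0 z + \<gamma> * qval Q1 z"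
        by (auto simp: L_def q_of_def)
      with assms(3) show "\<gamma> \<in> {0..(qval Q0 z - c) / - qval Q1 z}"
        by (simp add: field_simps)
    qed
    ultimately show ?thesis
      using bounded_closed_interval bounded_subset compact_eq_bounded_closed by blast
  qed
  \<comment> \<open>The real levels that the dual reaches somewhere; the supremum of
    \<open>S\<close> will be the optimal dual value.\<close>
  define S where "S = {c. L c \<noteq> {}}"
  have "c \<le> qval Q0 z" if "c \<in> S" for c
  proof -
    obtain \<gamma> where "0 \<le> \<gamma>" "c \<le> qval Q0 z + \<gamma> * qval Q1 z"
      using \<open>c \<in> S\<close> unfolding S_def L_def q_of_def by blast
    moreover have "\<gamma> * qval Q1 z \<le> 0"
      using \<open>0 \<le> \<gamma>\<close> assms(3) by (simp add: mult_nonneg_nonpos)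
    ultimately show ?thesis by linarith
  qed
  then have bdd: "bdd_above S" by (auto simp: bdd_above_def)
  have ne: "S \<noteq> {}"
    using assms(1,2) by (auto simp: S_def L_def)
  define F where "F n = L (Sup S - 1 / real (Suc n))" for n
  have "\<Inter>(range F) \<noteq> {}"
  proof (rule compact_nest)
    fix n
    have "Sup S - 1 / real (Suc n) < Sup S" by simp
    then obtain c where "c \<in> S" "Sup S - 1 / real (Suc n) < c"
      using less_cSup_iff[OF ne bdd] by blast
    then show "F n \<noteq> {}"
      unfolding F_def S_def L_def by (smt (verit) Collect_empty_eq mem_Collect_eq)
  next
    fix m n :: nat
    assume "m \<le> n"
    then have "1 / real (Suc n) \<le> 1 / real (Suc m)"
      by (simp add: frac_le)
    then show "F n \<subseteq> F m"
      unfolding F_def L_def by (smt (verit) Collect_mono)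
  qed (simp add: F_def \<open>\<And>c. compact (L c)\<close>)
  then obtain \<gamma> where \<gamma>: "\<And>n. \<gamma> \<in> F n" by blast
  have "Sup S \<le> q_of Q0 Q1 \<gamma> x" for x
  proof (rule field_le_epsilon)
    fix e :: real
    assume "e > 0"
    then obtain n where "1 / real (Suc n) < e"
      using nat_approx_posE by blast
    moreover have "Sup S - 1 / real (Suc n) \<le> q_of Q0 Q1 \<gamma> x"
      using \<gamma>[of n] by (simp add: F_def L_def)
    ultimately show "Sup S \<le> q_of Q0 Q1 \<gamma> x + e" by linarith
  qed
  then have ge: "ereal (Sup S) \<le> dual Q0 Q1 \<gamma>"
    by (simp add: le_dual_iff)
  have le: "dual Q0 Q1 \<beta> \<le> ereal (Sup S)" if "0 \<le> \<beta>" for \<beta>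
  proof (rule ereal_le_real)
    fix c
    assume "ereal (Sup S) \<le> ereal c"
    show "dual Q0 Q1 \<beta> \<le> ereal c"
    proof (rule ccontr)
      assume "\<not> ?thesis"
      \<comment> \<open>A real level strictly between is reached at \<open>\<beta>\<close>, hence
        belongs to \<open>S\<close> although it exceeds the supremum.\<close>
      then obtain r where "c < r" "ereal r < dual Q0 Q1 \<beta>"
        using ereal_dense2[of "ereal c" "dual Q0 Q1 \<beta>"] by (auto simp: not_le)
      then have "r \<in> S"
        using that le_dual_iff[of r \<beta>] by (auto simp: S_def L_def)
      then have "r \<le> Sup S" by (rule cSup_upper[OF _ bdd])
      with \<open>c < r\<close> \<open>ereal (Sup S) \<le> ereal c\<close> show False by simp
    qed
  qed
  have "\<gamma> \<ge> 0" using \<gamma>[of 0] by (simp add: F_def L_def)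
  with ge le have "dual_maximizer Q0 Q1 \<gamma>"
    unfolding dual_maximizer_def is_arg_max_def by (meson leD order_trans)
  with that show ?thesis .
qed

section \<open>Minimizers of symmetric pencils, first-order conditions on the dual, and the selected
  multiplier\<close>

context
  assumes sym0: "transpose (Mat Q0) = Mat Q0" and sym1: "transpose (Mat Q1) = Mat Q1"
begin

lemma transpose_A_of: "transpose (A_of Q0 Q1 \<gamma>) = A_of Q0 Q1 \<gamma>"
  using sym0 sym1 by (simp add: A_of_def transpose_def vec_eq_iff)

lemma pos_semidef_if_bounded_below:
  assumes "\<forall>x. D \<le> q_of Q0 Q1 \<gamma> x"
  shows "pos_semidef (A_of Q0 Q1 \<gamma>)"
  unfolding pos_semidef_def
proof (intro conjI allI transpose_A_of)
  fix x
  have "0 \<le> x \<bullet> (Mat (pencil \<gamma>) *v x)"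
    using bounded_below_quadratic_form_nonneg assms by (metis qval_pencil)
  then show "0 \<le> x \<bullet> (A_of Q0 Q1 \<gamma> *v x)"
    by (simp add: pencil_def)
qed

lemma q_of_stationary:
  assumes "A_of Q0 Q1 \<gamma> *v y + b_of Q0 Q1 \<gamma> = 0"
  shows "q_of Q0 Q1 \<gamma> x = q_of Q0 Q1 \<gamma> y + (x - y) \<bullet> (A_of Q0 Q1 \<gamma> *v (x - y))"
  using qval_add[of "pencil \<gamma>" y "x - y"] assms
  unfolding qval_pencil by (simp add: pencil_def transpose_A_of)

lemma stationary_minimizes:
  assumes "pos_def (A_of Q0 Q1 \<gamma>)" "A_of Q0 Q1 \<gamma> *v y + b_of Q0 Q1 \<gamma> = 0"
  shows "q_of Q0 Q1 \<gamma> y \<le> q_of Q0 Q1 \<gamma> x"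
    and "q_of Q0 Q1 \<gamma> x \<le> q_of Q0 Q1 \<gamma> y \<Longrightarrow> x = y"
proof -
  have *: "x = y \<or> 0 < (x - y) \<bullet> (A_of Q0 Q1 \<gamma> *v (x - y))"
    using assms(1) unfolding pos_def_def by (metis eq_iff_diff_eq_0)
  show "q_of Q0 Q1 \<gamma> y \<le> q_of Q0 Q1 \<gamma> x"
    using * q_of_stationary[OF assms(2), of x] by auto
  show "x = y" if "q_of Q0 Q1 \<gamma> x \<le> q_of Q0 Q1 \<gamma> y"
    using * q_of_stationary[OF assms(2), of x] that by linarith
qed

text \<open>Formulated for any stationary \<open>y\<close> because, when the dual has several
  maximizers, one point is stationary for all multipliers at once.\<close>

lemma dual_eq_stationary:
  assumes "pos_def (A_of Q0 Q1 \<gamma>)" "A_of Q0 Q1 \<gamma> *v y + b_of Q0 Q1 \<gamma> = 0"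
  shows "dual Q0 Q1 \<gamma> = ereal (q_of Q0 Q1 \<gamma> y)"
  unfolding dual_def
  by (rule antisym) (auto intro!: INF_lower2[of y] INF_greatest stationary_minimizes(1)[OF assms])

text \<open>Expand around \<open>x\<close> with \<open>y = z - x\<close>. For small
  \<open>h\<close>, half of the coercive term \<open>m * (norm y)^2\<close> absorbs the change of
  curvature \<open>h * k\<close>; the other half absorbs the linear term \<open>2 * h * a\<close> at
  a cost quadratic in \<open>h\<close>.\<close>

lemma dual_quadratic_lower_bound:
  assumes pd: "pos_def (A_of Q0 Q1 \<gamma>)"
  obtains C r where "r > 0" "C \<ge> 0"
    "\<And>h. \<bar>h\<bar> \<le> r \<Longrightarrow> ereal (q_of Q0 Q1 \<gamma> (x_of Q0 Q1 \<gamma>) + h * nu Q0 Q1 \<gamma> - C * h\<^sup>2)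
      \<le> dual Q0 Q1 (\<gamma> + h)"
proof -
  define x where "x = x_of Q0 Q1 \<gamma>"
  define g where "g = norm (Mat Q1 *v x + Vec Q1)"
  obtain m where m: "m > 0" "\<And>y. m * (norm y)\<^sup>2 \<le> y \<bullet> (A_of Q0 Q1 \<gamma> *v y)"
    using pos_def_coercive[OF pd] by blast
  obtain K where K: "K > 0" "\<And>y. \<bar>y \<bullet> (Mat Q1 *v y)\<bar> \<le> K * (norm y)\<^sup>2"
    using quadratic_form_bounded by blast
  have "q_of Q0 Q1 \<gamma> x + h * nu Q0 Q1 \<gamma> - 2 * g\<^sup>2 / m * h\<^sup>2 \<le> q_of Q0 Q1 (\<gamma> + h) z"
    if h: "\<bar>h\<bar> \<le> m / (2 * K)" for h z
  proof -
    define y where "y = z - x"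
    define a where "a = (Mat Q1 *v x + Vec Q1) \<bullet> y"
    define k where "k = y \<bullet> (Mat Q1 *v y)"
    have "\<bar>h * a\<bar> \<le> \<bar>h\<bar> * (g * norm y)"
      unfolding abs_mult a_def g_def by (intro mult_left_mono Cauchy_Schwarz_ineq2) simp
    moreover have "\<bar>h * k\<bar> \<le> m / 2 * (norm y)\<^sup>2"
    proof -
      have "\<bar>h * k\<bar> \<le> m / (2 * K) * (K * (norm y)\<^sup>2)"
        unfolding abs_mult k_def using m(1) K(1) by (intro mult_mono K h) auto
      then show ?thesis using K(1) by simp
    qed
    moreover have "2 * (\<bar>h\<bar> * (g * norm y)) \<le> m / 2 * (norm y)\<^sup>2 + 2 * g\<^sup>2 / m * h\<^sup>2"
    proof -
      \<comment> \<open>Young's inequality, weighted to spend exactly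
        \<open>m / 2 * (norm y)^2\<close>; this fixes \<open>C\<close> as
        \<open>2 * g^2 / m\<close>.\<close>
      have "0 \<le> (m * norm y - 2 * g * \<bar>h\<bar>)\<^sup>2 / (2 * m)"
        using m(1) by simp
      also have "\<dots> = m / 2 * (norm y)\<^sup>2 + 2 * g\<^sup>2 / m * \<bar>h\<bar>\<^sup>2 - 2 * (\<bar>h\<bar> * (g * norm y))"
        using m(1) by (simp add: power2_diff power_mult_distrib field_simps) (simp add: power2_eq_square)
      finally show ?thesis by simp
    qed
    moreover have "q_of Q0 Q1 (\<gamma> + h) z = q_of Q0 Q1 \<gamma> x + y \<bullet> (A_of Q0 Q1 \<gamma> *v y)
        + h * (nu Q0 Q1 \<gamma> + 2 * a + k)"
      using q_of_stationary[OF x_of_stationary[OF pd], of z] qval_add[OF sym1, of x y]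
      by (simp add: q_of_shift nu_def x_def y_def a_def k_def)
    moreover note m(2)[of y]
    ultimately show ?thesis
      by (simp only: distrib_left abs_le_iff) linarith
  qed
  then show ?thesis
    using m(1) K(1) by (intro that[of "m / (2 * K)" "2 * g\<^sup>2 / m"]) (auto simp: le_dual_iff x_def)
qed

text \<open>Maximality turns the lower bound into \<open>h * nu Q0 Q1 \<gamma> \<le> C * h^2\<close>
  for small admissible \<open>h\<close>. Positive \<open>h\<close> give the inequality; negative
  \<open>h\<close>, admissible only if \<open>\<gamma> > 0\<close>, give the equality.\<close>

lemma dual_maximizer_complementarity:
  assumes max: "dual_maximizer Q0 Q1 \<gamma>" and pd: "pos_def (A_of Q0 Q1 \<gamma>)"
  shows "nu Q0 Q1 \<gamma> \<le> 0" and "\<gamma> > 0 \<Longrightarrow> nu Q0 Q1 \<gamma> = 0"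
proof -
  define D where "D = q_of Q0 Q1 \<gamma> (x_of Q0 Q1 \<gamma>)"
  have ub: "dual Q0 Q1 \<beta> \<le> ereal D" if "\<beta> \<ge> 0" for \<beta>
    using max that unfolding dual_maximizer_def is_arg_max_def D_def
      dual_eq_stationary[OF pd x_of_stationary[OF pd], symmetric] by (meson not_less)
  obtain C r where r: "r > 0" "C \<ge> 0"
    and C: "\<And>h. \<bar>h\<bar> \<le> r \<Longrightarrow> ereal (D + h * nu Q0 Q1 \<gamma> - C * h\<^sup>2) \<le> dual Q0 Q1 (\<gamma> + h)"
    using dual_quadratic_lower_bound[OF pd] unfolding D_def by blast
  have key: "h * nu Q0 Q1 \<gamma> \<le> C * h\<^sup>2" if "\<bar>h\<bar> \<le> r" "\<gamma> + h \<ge> 0" for h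
    using order_trans[OF C[OF that(1)] ub[OF that(2)]] by simp
  have "\<gamma> \<ge> 0"
    using max by (simp add: dual_maximizer_def is_arg_max_def)
  show le: "nu Q0 Q1 \<gamma> \<le> 0"
  proof (rule ccontr)
    assume "\<not> ?thesis"
    then have n: "nu Q0 Q1 \<gamma> > 0" by simp
    \<comment> \<open>Dividing by \<open>C + 1\<close> covers \<open>C = 0\<close> and makes
      \<open>C * h\<close> strictly smaller than \<open>nu\<close>.\<close>
    define h where "h = min r (nu Q0 Q1 \<gamma> / (C + 1))"
    have h: "h > 0" "h \<le> r" using n r by (auto simp: h_def)
    have "C * h < (C + 1) * h" using h by simp
    also have "\<dots> \<le> (C + 1) * (nu Q0 Q1 \<gamma> / (C + 1))"
      using r by (intro mult_left_mono) (auto simp: h_def)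
    also have "\<dots> = nu Q0 Q1 \<gamma>"
      using r by simp
    finally have "C * h\<^sup>2 < h * nu Q0 Q1 \<gamma>"
      using h by (simp add: power2_eq_square mult_ac)
    with key[of h] h \<open>\<gamma> \<ge> 0\<close> show False by simp
  qed
  show "nu Q0 Q1 \<gamma> = 0" if "\<gamma> > 0"
  proof (rule ccontr)
    assume "\<not> ?thesis"
    then have n: "- nu Q0 Q1 \<gamma> > 0" using le by simp
    \<comment> \<open>The step is taken to the left; the cap \<open>\<gamma>\<close> keeps
      \<open>\<gamma> - h\<close> nonnegative.\<close>
    define h where "h = min (min r \<gamma>) (- nu Q0 Q1 \<gamma> / (C + 1))"
    have h: "h > 0" "h \<le> r" "h \<le> \<gamma>" using n r that by (auto simp: h_def divide_neg_pos)
    have "C * h < (C + 1) * h" using h by simp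
    also have "\<dots> \<le> (C + 1) * (- nu Q0 Q1 \<gamma> / (C + 1))"
      using r by (intro mult_left_mono) (auto simp: h_def)
    also have "\<dots> = - nu Q0 Q1 \<gamma>"
      using r by simp
    finally have "C * h * h < - nu Q0 Q1 \<gamma> * h"
      using h by (intro mult_strict_right_mono)
    with key[of "- h"] h show False by (simp add: power2_eq_square mult_ac)
  qed
qed

text \<open>Without uniqueness \<open>gamma_star\<close> is selected through \<open>mu\<close>; this
  lemma certifies that it still maximizes the dual.\<close>

lemma dual_maximizer_if_not_unique:
  assumes a: "dual_maximizer Q0 Q1 \<alpha>" and b: "dual_maximizer Q0 Q1 \<beta>" and "\<alpha> < \<beta>"
    and pd: "pos_def (A_of Q0 Q1 \<gamma>)" and "\<gamma> \<ge> 0"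
  shows "dual_maximizer Q0 Q1 \<gamma>"
proof -
  have nonneg: "\<alpha> \<ge> 0" "\<beta> \<ge> 0" and eq: "dual Q0 Q1 \<alpha> = dual Q0 Q1 \<beta>"
    and max: "\<And>\<delta>. \<delta> \<ge> 0 \<Longrightarrow> dual Q0 Q1 \<delta> \<le> dual Q0 Q1 \<alpha>"
    using a b unfolding dual_maximizer_def is_arg_max_def
    by (auto simp: not_less intro: antisym)
  have "dual Q0 Q1 \<alpha> \<le> ereal (q_of Q0 Q1 \<alpha> 0)"
    unfolding dual_def by (rule INF_lower) simp
  moreover have "ereal (q_of Q0 Q1 \<gamma> (x_of Q0 Q1 \<gamma>)) \<le> dual Q0 Q1 \<alpha>"
    using max[OF \<open>\<gamma> \<ge> 0\<close>] dual_eq_stationary[OF pd x_of_stationary[OF pd]] by simp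
  ultimately obtain D where D: "dual Q0 Q1 \<alpha> = ereal D"
    by (cases "dual Q0 Q1 \<alpha>") auto
  have lo: "\<forall>x. D \<le> q_of Q0 Q1 \<alpha> x" "\<forall>x. D \<le> q_of Q0 Q1 \<beta> x"
    using D eq by (metis le_dual_iff order_refl)+
  have between: "pos_def (A_of Q0 Q1 \<delta>)"  "qval Q1 (x_of Q0 Q1 \<delta>) = 0"
    "qval Q0 (x_of Q0 Q1 \<delta>) = D" if \<delta>: "\<alpha> < \<delta>" "\<delta> < \<beta>" for \<delta>
  proof -
    let ?x = "x_of Q0 Q1 \<delta>"
    show pd\<delta>: "pos_def (A_of Q0 Q1 \<delta>)"
      using pos_def_between pos_semidef_if_bounded_below lo pd \<delta> transpose_A_of by blast
    have "q_of Q0 Q1 \<delta> ?x \<le> D"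
      using max[of \<delta>] D dual_eq_stationary[OF pd\<delta> x_of_stationary[OF pd\<delta>]] \<delta> nonneg by simp
    \<comment> \<open>Moving the multiplier from \<open>\<delta>\<close> to either end changes the
      value at \<open>?x\<close> by amounts of opposite sign, and neither may be negative.\<close>
    moreover have "D \<le> q_of Q0 Q1 \<delta> ?x + (\<alpha> - \<delta>) * qval Q1 ?x"
      "D \<le> q_of Q0 Q1 \<delta> ?x + (\<beta> - \<delta>) * qval Q1 ?x"
      using lo by (simp_all flip: q_of_shift)
    ultimately have "0 \<le> (\<alpha> - \<delta>) * qval Q1 ?x" "0 \<le> (\<beta> - \<delta>) * qval Q1 ?x"
      and D': "q_of Q0 Q1 \<delta> ?x \<le> D"
      by linarith+
    then show z: "qval Q1 ?x = 0"
      using \<delta> by (simp add: zero_le_mult_iff)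
    show "qval Q0 ?x = D"
      using D' lo(1)[rule_format, of ?x] z by (simp add: q_of_def)
  qed
  obtain \<delta> where \<delta>: "\<alpha> < \<delta>" "\<delta> < \<beta>" using dense[OF \<open>\<alpha> < \<beta>\<close>] by blast
  obtain \<epsilon> where \<epsilon>: "\<delta> < \<epsilon>" "\<epsilon> < \<beta>" using dense[OF \<delta>(2)] by blast
  define y where "y = x_of Q0 Q1 \<delta>"
  note d = between[OF \<delta>] and e = between[OF less_trans[OF \<delta>(1) \<epsilon>(1)] \<epsilon>(2)]
  \<comment> \<open>At \<open>y\<close> the aggregated value is \<open>D\<close> for every
    multiplier, and \<open>D\<close> is the minimum for \<open>\<epsilon>\<close>, whose minimizer
    is unique.\<close>
  have "y = x_of Q0 Q1 \<epsilon>"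
    by (rule stationary_minimizes(2)[OF e(1) x_of_stationary[OF e(1)]])
      (simp add: q_of_def y_def d e)
  then have "A_of Q0 Q1 \<delta> *v y + b_of Q0 Q1 \<delta> = 0" "A_of Q0 Q1 \<epsilon> *v y + b_of Q0 Q1 \<epsilon> = 0"
    using x_of_stationary[OF d(1)] x_of_stationary[OF e(1)] by (simp_all add: y_def)
  moreover have grad: "A_of Q0 Q1 \<theta> *v y + b_of Q0 Q1 \<theta> =
      (Mat Q0 *v y + Vec Q0) + \<theta> *\<^sub>R (Mat Q1 *v y + Vec Q1)" for \<theta>
    by (simp add: A_of_def b_of_def matrix_vector_mult_add_rdistrib
        scaleR_matrix_vector_assoc[symmetric] algebra_simps)
  ultimately have "(\<epsilon> - \<delta>) *\<^sub>R (Mat Q1 *v y + Vec Q1) = 0"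
    unfolding scaleR_left_diff_distrib by (metis add_left_cancel cancel_comm_monoid_add_class.diff_cancel)
  then have "Mat Q1 *v y + Vec Q1 = 0"
    using \<epsilon>(1) by simp
  with grad \<open>A_of Q0 Q1 \<delta> *v y + b_of Q0 Q1 \<delta> = 0\<close>
  have "A_of Q0 Q1 \<gamma> *v y + b_of Q0 Q1 \<gamma> = 0"
    by simp
  from dual_eq_stationary[OF pd this] have "dual Q0 Q1 \<gamma> = dual Q0 Q1 \<alpha>"
    by (simp add: q_of_def y_def d D)
  with max \<open>\<gamma> \<ge> 0\<close> show ?thesis
    by (auto simp: dual_maximizer_def is_arg_max_def not_less)
qed

text \<open>Definiteness makes the dual finite at \<open>gamma_star\<close>, so a maximizer exists.
  This must be known first: the second branch of \<open>gamma_star\<close> also covers the absence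
  of maximizers.\<close>

lemma gamma_star_dual_maximizer:
  assumes "qval Q1 z < 0" and "mu_star Q0 Q1 > 0" and "gamma_star Q0 Q1 \<ge> 0"
  shows "pos_def (A_of Q0 Q1 (gamma_star Q0 Q1))" "dual_maximizer Q0 Q1 (gamma_star Q0 Q1)"
proof -
  show pd: "pos_def (A_of Q0 Q1 (gamma_star Q0 Q1))"
    using assms(2) transpose_A_of by (simp add: mu_star_def mu_def pos_def_if_lambda_min_pos)
  obtain \<alpha> where \<alpha>: "dual_maximizer Q0 Q1 \<alpha>"
    using dual_maximizer_exists[OF assms(3) _ assms(1)]
      stationary_minimizes(1)[OF pd x_of_stationary[OF pd]] by blast
  show "dual_maximizer Q0 Q1 (gamma_star Q0 Q1)"
  proof (cases "\<exists>!\<gamma>. dual_maximizer Q0 Q1 \<gamma>")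
    case True
    then show ?thesis
      using theI'[OF True] by (simp add: gamma_star_def)
  next
    case False
    with \<alpha> obtain \<beta> where "dual_maximizer Q0 Q1 \<beta>" "\<beta> \<noteq> \<alpha>" by blast
    with \<alpha> show ?thesis
      using dual_maximizer_if_not_unique[OF _ _ _ pd assms(3)] by (metis linorder_cases)
  qed
qed

section \<open>Strong convexity over the interior of \<open>Gamma_set\<close>\<close>

lemma pos_def_interior_Gamma:
  assumes "\<gamma> \<in> interior (Gamma_set Q0 Q1)" and "pos_def (A_of Q0 Q1 \<delta>)"
  shows "pos_def (A_of Q0 Q1 \<gamma>)"
proof -
  obtain e where e: "e > 0" "cball \<gamma> e \<subseteq> Gamma_set Q0 Q1"
    using assms(1) by (auto simp: mem_interior_cball)
  then have "\<gamma> - e \<in> Gamma_set Q0 Q1" "\<gamma> + e \<in> Gamma_set Q0 Q1"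
    by (auto simp: dist_real_def subset_iff)
  then show ?thesis
    using pos_def_between[of "\<gamma> - e" "\<gamma> + e" \<delta> \<gamma>] e(1) assms(2) transpose_A_of
    by (simp add: Gamma_set_def)
qed

lemma strongly_convex_q_of:
  assumes "pos_def (A_of Q0 Q1 \<gamma>)"
  shows "strongly_convex_on UNIV (q_of Q0 Q1 \<gamma>)"
proof -
  obtain m where m: "m > 0" "\<And>y. m * (norm y)\<^sup>2 \<le> y \<bullet> (A_of Q0 Q1 \<gamma> *v y)"
    using pos_def_coercive[OF assms] by blast
  \<comment> \<open>The modulus is \<open>2 * m\<close> because the Hessian is twice
    \<open>A_of Q0 Q1 \<gamma>\<close>.\<close>
  have "q_of Q0 Q1 \<gamma> ((1 - t) *\<^sub>R x + t *\<^sub>R y) \<le> (1 - t) * q_of Q0 Q1 \<gamma> x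
      + t * q_of Q0 Q1 \<gamma> y - 2 * m / 2 * t * (1 - t) * (norm (x - y))\<^sup>2" if "t \<in> {0..1}" for x y t
  proof -
    have "t * (1 - t) * (m * (norm (x - y))\<^sup>2)
        \<le> t * (1 - t) * ((x - y) \<bullet> (A_of Q0 Q1 \<gamma> *v (x - y)))"
      using that by (intro mult_left_mono m) auto
    moreover have "q_of Q0 Q1 \<gamma> ((1 - t) *\<^sub>R x + t *\<^sub>R y) = (1 - t) * q_of Q0 Q1 \<gamma> x
        + t * q_of Q0 Q1 \<gamma> y - t * (1 - t) * ((x - y) \<bullet> (A_of Q0 Q1 \<gamma> *v (x - y)))"
      using qval_affine_combination[of "pencil \<gamma>" t x y]
      unfolding qval_pencil by (simp add: pencil_def transpose_A_of)
    ultimately show ?thesis by (simp add: mult_ac)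
  qed
  with m(1) show ?thesis
    unfolding strongly_convex_on_def by (intro conjI convex_UNIV exI[of _ "2 * m"]) auto
qed

end

end

lemma strongly_convex_on_max:
  assumes "strongly_convex_on S f" "strongly_convex_on S g"
  shows "strongly_convex_on S (\<lambda>x. max (f x) (g x))"
proof -
  obtain \<alpha> where \<alpha>: "\<alpha> > 0" "\<And>x y t. x \<in> S \<Longrightarrow> y \<in> S \<Longrightarrow> t \<in> {0..1} \<Longrightarrow>
      f ((1 - t) *\<^sub>R x + t *\<^sub>R y) \<le> (1 - t) * f x + t * f y - \<alpha> / 2 * t * (1 - t) * (norm (x - y))\<^sup>2"
    using assms(1) unfolding strongly_convex_on_def by blast
  obtain \<beta> where \<beta>: "\<beta> > 0" "\<And>x y t. x \<in> S \<Longrightarrow> y \<in> S \<Longrightarrow> t \<in> {0..1} \<Longrightarrow>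
      g ((1 - t) *\<^sub>R x + t *\<^sub>R y) \<le> (1 - t) * g x + t * g y - \<beta> / 2 * t * (1 - t) * (norm (x - y))\<^sup>2"
    using assms(2) unfolding strongly_convex_on_def by blast
  have "max (f ((1 - t) *\<^sub>R x + t *\<^sub>R y)) (g ((1 - t) *\<^sub>R x + t *\<^sub>R y))
      \<le> (1 - t) * max (f x) (g x) + t * max (f y) (g y)
        - min \<alpha> \<beta> / 2 * t * (1 - t) * (norm (x - y))\<^sup>2"
    if xy: "x \<in> S" "y \<in> S" and t: "t \<in> {0..1}" for x y t
  proof -
    have "(1 - t) * f x \<le> (1 - t) * max (f x) (g x)" "t * f y \<le> t * max (f y) (g y)"
      "(1 - t) * g x \<le> (1 - t) * max (f x) (g x)" "t * g y \<le> t * max (f y) (g y)"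
      using t by (auto intro!: mult_left_mono)
    moreover have "min \<alpha> \<beta> / 2 * t * (1 - t) * (norm (x - y))\<^sup>2
        \<le> \<alpha> / 2 * t * (1 - t) * (norm (x - y))\<^sup>2"
      "min \<alpha> \<beta> / 2 * t * (1 - t) * (norm (x - y))\<^sup>2 \<le> \<beta> / 2 * t * (1 - t) * (norm (x - y))\<^sup>2"
      using t by (auto intro!: mult_right_mono)
    ultimately show ?thesis
      using \<alpha>(2)[OF xy t] \<beta>(2)[OF xy t] by (intro max.boundedI) linarith+
  qed
  moreover have "min \<alpha> \<beta> > 0" using \<alpha>(1) \<beta>(1) by simp
  ultimately show ?thesis
    using assms(1) unfolding strongly_convex_on_def by blast
qed

section \<open>Unique optimality in both problems\<close>

lemma unique_minimizerI:
  fixes f :: "'a \<Rightarrow> real"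
  assumes "P x" and "\<And>y. P y \<Longrightarrow> f x \<le> f y" and "\<And>y. P y \<Longrightarrow> f y \<le> f x \<Longrightarrow> y = x"
  shows "unique_minimizer f P x"
  using assms unfolding unique_minimizer_def is_arg_min_def by (meson not_less)

theorem lemma3:
  fixes Q0 Q1 :: "'n::finite quadratic"
    and \<gamma>1 \<gamma>2 :: real
  assumes "transpose (Mat Q0) = Mat Q0" and "transpose (Mat Q1) = Mat Q1"
    and "\<exists>xbar. qval Q1 xbar < 0"
    and "\<exists>\<gamma>bar\<ge>0. pos_def (A_of Q0 Q1 \<gamma>bar)"
    and "mu_star Q0 Q1 > 0"
    and "{\<gamma>1..\<gamma>2} \<subseteq> {0..}"
    and "gamma_star Q0 Q1 \<in> {\<gamma>1..\<gamma>2}"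
  shows "(gamma_star Q0 Q1 \<in> interior (Gamma_set Q0 Q1) \<longrightarrow> nu Q0 Q1 (gamma_star Q0 Q1) = 0)
    \<and> unique_minimizer (qval Q0) (\<lambda>x. qval Q1 x \<le> 0) (x_of Q0 Q1 (gamma_star Q0 Q1))
    \<and> unique_minimizer (\<lambda>x. max (q_of Q0 Q1 \<gamma>1 x) (q_of Q0 Q1 \<gamma>2 x)) (\<lambda>x. True)
        (x_of Q0 Q1 (gamma_star Q0 Q1))
    \<and> ({\<gamma>1..\<gamma>2} \<subseteq> interior (Gamma_set Q0 Q1) \<longrightarrow>
        unique_minimizer (\<lambda>x. max (q_of Q0 Q1 \<gamma>1 x) (q_of Q0 Q1 \<gamma>2 x)) (\<lambda>x. True)
          (x_of Q0 Q1 (gamma_star Q0 Q1))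
        \<and> strongly_convex_on UNIV (\<lambda>x. max (q_of Q0 Q1 \<gamma>1 x) (q_of Q0 Q1 \<gamma>2 x)))"
proof -
  define \<gamma> where "\<gamma> = gamma_star Q0 Q1"
  define x where "x = x_of Q0 Q1 \<gamma>"
  have bounds: "\<gamma> \<ge> 0" "\<gamma>1 \<le> \<gamma>" "\<gamma> \<le> \<gamma>2" "\<gamma>1 \<ge> 0"
    using assms(6,7) by (auto simp: \<gamma>_def)
  obtain z where "qval Q1 z < 0" using assms(3) by blast
  then have pd: "pos_def (A_of Q0 Q1 \<gamma>)" and max: "dual_maximizer Q0 Q1 \<gamma>"
    using gamma_star_dual_maximizer[OF assms(1,2) _ assms(5)] bounds(1) by (auto simp: \<gamma>_def)
  have nu: "qval Q1 x \<le> 0" "\<gamma> > 0 \<Longrightarrow> qval Q1 x = 0"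
    using dual_maximizer_complementarity[OF assms(1,2) max pd] by (auto simp: nu_def x_def)
  note min = stationary_minimizes[OF assms(1,2) pd x_of_stationary[OF pd], folded x_def]
  \<comment> \<open>Complementary slackness. The aggregated function lies below the first objective
    on its feasible set and below the second everywhere, and agrees with both at \<open>x\<close>,
    so its unique minimizer serves both problems.\<close>
  have qx: "q_of Q0 Q1 \<gamma> x = qval Q0 x"
    using nu(2) bounds(1) by (cases "\<gamma> = 0") (auto simp: q_of_def)
  have "nu Q0 Q1 \<gamma> = 0" if "\<gamma> \<in> interior (Gamma_set Q0 Q1)"
  proof -
    \<comment> \<open>The interior is taken in the whole real line, which excludes
      \<open>0\<close>.\<close>
    have "interior (Gamma_set Q0 Q1) \<subseteq> interior {0..}"
      by (intro interior_mono) (auto simp: Gamma_set_def)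
    with that have "\<gamma> > 0" by auto
    with nu(2) show ?thesis by (simp add: nu_def x_def)
  qed
  moreover have "unique_minimizer (qval Q0) (\<lambda>x. qval Q1 x \<le> 0) x"
  proof (rule unique_minimizerI)
    fix y
    assume "qval Q1 y \<le> 0"
    then have le: "q_of Q0 Q1 \<gamma> y \<le> qval Q0 y"
      using bounds(1) by (simp add: q_of_def mult_nonneg_nonpos)
    show "qval Q0 x \<le> qval Q0 y"
      using min(1)[of y] le qx by linarith
    show "y = x" if "qval Q0 y \<le> qval Q0 x"
      using min(2)[of y] le qx that by linarith
  qed (fact nu(1))
  moreover have "unique_minimizer (\<lambda>x. max (q_of Q0 Q1 \<gamma>1 x) (q_of Q0 Q1 \<gamma>2 x)) (\<lambda>x. True) x"
  proof (rule unique_minimizerI)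
    \<comment> \<open>If \<open>\<gamma> = 0\<close>, then \<open>\<gamma>1 = 0\<close> as well, and
      \<open>qval Q1 x\<close> may be negative; the maximum is then attained by the first
      term.\<close>
    have "\<gamma>1 * qval Q1 x = 0 \<and> \<gamma>2 * qval Q1 x \<le> 0"
    proof (cases "\<gamma> = 0")
      case True
      with bounds nu(1) show ?thesis by (auto simp: mult_nonneg_nonpos)
    next
      case False
      with bounds(1) nu(2) show ?thesis by auto
    qed
    then have mx: "max (q_of Q0 Q1 \<gamma>1 x) (q_of Q0 Q1 \<gamma>2 x) = qval Q0 x"
      by (auto simp: q_of_def max_def)
    fix y
    \<comment> \<open>A linear function on an interval is largest at an endpoint.\<close>
    have "\<gamma> * qval Q1 y \<le> max (\<gamma>1 * qval Q1 y) (\<gamma>2 * qval Q1 y)"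
      using bounds by (cases "qval Q1 y \<ge> 0")
        (auto simp: le_max_iff_disj intro: mult_right_mono mult_right_mono_neg)
    then have le: "q_of Q0 Q1 \<gamma> y \<le> max (q_of Q0 Q1 \<gamma>1 y) (q_of Q0 Q1 \<gamma>2 y)"
      by (auto simp: q_of_def)
    show "max (q_of Q0 Q1 \<gamma>1 x) (q_of Q0 Q1 \<gamma>2 x) \<le> max (q_of Q0 Q1 \<gamma>1 y) (q_of Q0 Q1 \<gamma>2 y)"
      using min(1)[of y] le qx mx by linarith
    show "y = x" if "max (q_of Q0 Q1 \<gamma>1 y) (q_of Q0 Q1 \<gamma>2 y)
        \<le> max (q_of Q0 Q1 \<gamma>1 x) (q_of Q0 Q1 \<gamma>2 x)"
      using min(2)[of y] le qx mx that by linarith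
  qed simp
  moreover have "strongly_convex_on UNIV (\<lambda>x. max (q_of Q0 Q1 \<gamma>1 x) (q_of Q0 Q1 \<gamma>2 x))"
    if "{\<gamma>1..\<gamma>2} \<subseteq> interior (Gamma_set Q0 Q1)"
  proof -
    have "\<gamma>1 \<in> {\<gamma>1..\<gamma>2}" "\<gamma>2 \<in> {\<gamma>1..\<gamma>2}"
      using bounds by auto
    with that show ?thesis
      using pos_def_interior_Gamma[OF assms(1,2) _ pd] strongly_convex_q_of[OF assms(1,2)]
      by (blast intro: strongly_convex_on_max)
  qed
  ultimately show ?thesis
    unfolding x_def \<gamma>_def by blast
qed

end
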